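(* Let $G$ be a connected graph of order $n\geq 5$, minimum degree $\delta\geq 2$ and vertex-connectivity $\kappa$. If $$\rho(G) \geq \frac{\delta-1}{2}+\sqrt{(n-\delta-1)(n-4) + \frac{(\delta+1)^2}{4}},$$ then $\kappa=\delta$, unless $G\cong K_{n-4}\vee (K_2\cup K_2)$.
   Context: All graphs are finite, simple and undirected. $\rho(G)$ denotes the spectral radius (largest eigenvalue) of the adjacency matrix of $G$. The vertex-connectivity $\kappa(G)$ of a connected non-complete graph is the minimum size of a vertex set whose removal disconnects $G$, and $\kappa(K_n)=n-1$. $K_r$ is the complete graph on $r$ vertices, $\cup$ is disjoint union and $G_1\vee G_2$ is the join (disjoint union plus all edges between $G_1$ and $G_2$). *)

theory Defs
  imports
    "Graph_Theory.Graph_Theory"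
    "Jordan_Normal_Form.Spectral_Radius"
begin

text \<open>
  A finite simple undirected graph is a \<open>pair_graph\<close> of the Graph Theory library: a finite
  loop-free digraph without parallel arcs whose arc relation is symmetric, each edge \<open>{u, v}\<close> being
  the two arcs \<open>(u, v)\<close> and \<open>(v, u)\<close>.  The degree of a vertex is therefore its out-degree (counting
  in- and out-arcs together would count every edge twice).
\<close>

definition min_degree :: "'a pair_pre_digraph \<Rightarrow> nat" where
  "min_degree G = Min (out_degree (with_proj G) ` pverts G)"

definition disconnecting_set :: "'a pair_pre_digraph \<Rightarrow> 'a set \<Rightarrow> bool" where
  "disconnecting_set G S \<longleftrightarrow>
     S \<subset> pverts G \<and> \<not> Digraph_Component.connected (with_proj G \<restriction> (pverts G - S))"

text \<open>
  \<open>S\<close> has to be a proper subset because the library counts the empty graph as not connected.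
\<close>

definition vertex_connectivity :: "'a pair_pre_digraph \<Rightarrow> nat" where
  "vertex_connectivity G =
     (if complete_digraph (card (pverts G)) (with_proj G) then card (pverts G) - 1
      else Min (card ` {S. disconnecting_set G S}))"

definition adjacency_mat :: "'a pair_pre_digraph \<Rightarrow> 'a list \<Rightarrow> complex mat" where
  "adjacency_mat G vs =
     mat (length vs) (length vs) (\<lambda>(i, j). if (vs ! i, vs ! j) \<in> parcs G then 1 else 0)"

text \<open>
  The choice of the enumeration of the vertices does not matter: by the lemma
  \<open>eigenvalue_adjacency_mat\<close> below the eigenvalues do not depend on it.  As the adjacency matrix is
  real symmetric with nonnegative entries, the maximal modulus of an eigenvalue, which is what
  \<open>spectral_radius\<close> denotes, is the largest eigenvalue (Perron--Frobenius).
\<close>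

definition graph_spectral_radius :: "'a pair_pre_digraph \<Rightarrow> real" where
  "graph_spectral_radius G =
     spectral_radius (adjacency_mat G (SOME vs. distinct vs \<and> set vs = pverts G))"

lemma eigenvalue_adjacency_mat:
  assumes "distinct vs" and "set vs = pverts G"
  shows "eigenvalue (adjacency_mat G vs) k \<longleftrightarrow>
    (\<exists>f. (\<exists>v\<in>pverts G. f v \<noteq> 0) \<and>
         (\<forall>v\<in>pverts G. (\<Sum>u | u \<in> pverts G \<and> (v, u) \<in> parcs G. f u) = k * f v))"
    (is "?L \<longleftrightarrow> ?R")
proof -
  let ?n = "length vs"
  have V: "pverts G = (!) vs ` {0..<?n}"
    unfolding assms(2)[symmetric] by (auto simp: set_conv_nth)
  have inj: "inj_on ((!) vs) {0..<?n}"
    using assms(1) by (auto simp: inj_on_def nth_eq_iff_index_eq)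
  have fin: "finite (pverts G)"
    using assms(2) by (metis List.finite_set)
  have row: "(\<Sum>u | u \<in> pverts G \<and> (v, u) \<in> parcs G. f u) =
      (\<Sum>j = 0..<?n. (if (v, vs ! j) \<in> parcs G then 1 else 0) * f (vs ! j))"
    for v and f :: "'a \<Rightarrow> complex"
  proof -
    have "(\<Sum>u | u \<in> pverts G \<and> (v, u) \<in> parcs G. f u) =
        (\<Sum>u\<in>pverts G. (if (v, u) \<in> parcs G then 1 else 0) * f u)"
      using fin by (intro sum.mono_neutral_cong_left) auto
    also have "\<dots> = (\<Sum>j = 0..<?n. (if (v, vs ! j) \<in> parcs G then 1 else 0) * f (vs ! j))"
      unfolding V by (simp add: sum.reindex[OF inj])
    finally show ?thesis .
  qed
  have mul: "(adjacency_mat G vs *\<^sub>v w) $ i =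
      (\<Sum>j = 0..<?n. (if (vs ! i, vs ! j) \<in> parcs G then 1 else 0) * w $ j)"
    if "w \<in> carrier_vec ?n" "i < ?n" for w i
    using that by (simp add: adjacency_mat_def scalar_prod_def)
  have dim: "dim_row (adjacency_mat G vs) = ?n"
    by (simp add: adjacency_mat_def)
  show ?thesis
  proof
    assume ?L
    then obtain w where w: "w \<in> carrier_vec ?n" "w \<noteq> 0\<^sub>v ?n"
      "adjacency_mat G vs *\<^sub>v w = k \<cdot>\<^sub>v w"
      by (auto simp: eigenvalue_def eigenvector_def dim)
    define f where "f v = w $ (the_inv_into {0..<?n} ((!) vs) v)" for v
    have f: "f (vs ! i) = w $ i" if "i < ?n" for i
      using that inj by (simp add: f_def the_inv_into_f_f)
    obtain i where i: "i < ?n" "w $ i \<noteq> 0"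
      using w(1,2) by (metis carrier_vecD eq_vecI index_zero_vec)
    have "\<exists>v\<in>pverts G. f v \<noteq> 0"
      using i f[of i] unfolding V by (auto intro: bexI[of _ i])
    moreover have "(\<Sum>u | u \<in> pverts G \<and> (v, u) \<in> parcs G. f u) = k * f v"
      if "v \<in> pverts G" for v
    proof -
      obtain l where l: "l < ?n" "v = vs ! l"
        using \<open>v \<in> pverts G\<close> unfolding V by auto
      have "(\<Sum>u | u \<in> pverts G \<and> (v, u) \<in> parcs G. f u) = (adjacency_mat G vs *\<^sub>v w) $ l"
        unfolding row mul[OF w(1) l(1)] l(2) by (intro sum.cong) (auto simp: f)
      also have "\<dots> = k * f v" using w(1,3) l f by simp
      finally show ?thesis .
    qed
    ultimately show ?R by blast
  next
    assume ?R
    then obtain f where f: "\<exists>v\<in>pverts G. f v \<noteq> 0"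
      "\<And>v. v \<in> pverts G \<Longrightarrow> (\<Sum>u | u \<in> pverts G \<and> (v, u) \<in> parcs G. f u) = k * f v"
      by blast
    define w where "w = vec ?n (\<lambda>i. f (vs ! i))"
    have w: "w \<in> carrier_vec ?n" by (simp add: w_def)
    obtain i where i: "i < ?n" "f (vs ! i) \<noteq> 0" using f(1) unfolding V by auto
    have "w \<noteq> 0\<^sub>v ?n"
    proof
      assume "w = 0\<^sub>v ?n"
      then have "w $ i = 0" using i(1) by simp
      then show False using i by (simp add: w_def)
    qed
    moreover have "adjacency_mat G vs *\<^sub>v w = k \<cdot>\<^sub>v w"
    proof (rule eq_vecI)
      fix l assume "l < dim_vec (k \<cdot>\<^sub>v w)"
      then have l: "l < ?n" by (simp add: w_def)
      then have "(adjacency_mat G vs *\<^sub>v w) $ l = (\<Sum>u | u \<in> pverts G \<and> (vs ! l, u) \<in> parcs G. f u)"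
        unfolding row mul[OF w l] by (intro sum.cong) (auto simp: w_def)
      also have "\<dots> = k * f (vs ! l)" using f(2) l assms(2) nth_mem by metis
      finally show "(adjacency_mat G vs *\<^sub>v w) $ l = (k \<cdot>\<^sub>v w) $ l"
        using l by (simp add: w_def)
    qed (simp add: w_def dim)
    ultimately show ?L
      using w by (auto simp: eigenvalue_def eigenvector_def dim)
  qed
qed

definition complete_graph :: "nat \<Rightarrow> nat pair_pre_digraph" where
  "complete_graph r = \<lparr> pverts = {..<r}, parcs = {(u, v). u < r \<and> v < r \<and> u \<noteq> v} \<rparr>"

definition disjoint_union ::
    "'a pair_pre_digraph \<Rightarrow> 'b pair_pre_digraph \<Rightarrow> ('a + 'b) pair_pre_digraph" where
  "disjoint_union G H =
     \<lparr> pverts = pverts G <+> pverts H,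
       parcs = map_prod Inl Inl ` parcs G \<union> map_prod Inr Inr ` parcs H \<rparr>"

definition graph_join ::
    "'a pair_pre_digraph \<Rightarrow> 'b pair_pre_digraph \<Rightarrow> ('a + 'b) pair_pre_digraph" where
  "graph_join G H =
     \<lparr> pverts = pverts G <+> pverts H,
       parcs = parcs (disjoint_union G H) \<union>
         Inl ` pverts G \<times> Inr ` pverts H \<union> Inr ` pverts H \<times> Inl ` pverts G \<rparr>"

end

theory Submission
  imports Defs
begin

text \<open>
  Let \<open>y\<close> be the vector of absolute values of an eigenvector for an eigenvalue of modulus
  \<open>\<rho>\<close>, so that \<open>A y \<ge> \<rho> y \<ge> 0\<close>; this weak form of Perron--Frobenius suffices.  Summing the
  entries of \<open>(A\<^sup>2 - (\<delta> - 1) A) y\<close> gives \<open>\<rho> (\<rho> - \<delta> + 1) \<le> 2m - (n - 1) \<delta>\<close>.  If \<open>\<kappa> < \<delta>\<close>, a minimum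
  cut \<open>S\<close> leaves two parts of sizes \<open>a, b \<ge> \<delta> - \<kappa> + 1 \<ge> 2\<close> without edges between them, so
  \<open>2m \<le> n (n - 1) - 2ab \<le> n (n - 1) - 4 (n - \<delta> - 1)\<close>.  The hypothesis on \<open>\<rho>\<close> therefore forces
  equality everywhere: all edges but those between the two parts are present, \<open>y\<close> is a positive
  eigenvector, and every vertex with a non-neighbour has degree \<open>\<delta>\<close>, whence \<open>a = b = 2\<close>.
\<close>

section \<open>Connectedness and separations\<close>

text \<open>Connectedness is strong connectedness of \<open>mk_symmetric G\<close>. If it fails,
  take for \<open>A\<close> everything reachable there from one vertex; conversely, no walk leaves a
  set that each arc respects.\<close>

lemma (in wf_digraph) not_connected_iff:
  assumes "verts G \<noteq> {}"
  shows "\<not> connected G \<longleftrightarrow>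
    (\<exists>A\<subseteq>verts G. A \<noteq> {} \<and> A \<noteq> verts G \<and> (\<forall>e\<in>arcs G. tail G e \<in> A \<longleftrightarrow> head G e \<in> A))"
    (is "_ \<longleftrightarrow> ?R")
proof
  interpret M: pair_wf_digraph "mk_symmetric G"
    by unfold_locales (auto simp: mk_symmetric_def)
  have arc: "(tail G e, head G e) \<in> parcs (mk_symmetric G)"
    "(head G e, tail G e) \<in> parcs (mk_symmetric G)" if "e \<in> arcs G" for e
    using that by (auto simp: mk_symmetric_def)
  {
    assume "\<not> connected G"
    then obtain u v where uv: "u \<in> verts G" "v \<in> verts G" "\<not> u \<rightarrow>\<^sup>*\<^bsub>mk_symmetric G\<^esub> v"
      using assms by (auto simp: connected_def strongly_connected_def)
    define A where "A = {w \<in> verts G. u \<rightarrow>\<^sup>*\<^bsub>mk_symmetric G\<^esub> w}"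
    have "u \<in> A" using uv(1) M.reachable_refl[of u] by (simp add: A_def)
    moreover have "v \<notin> A" using uv(3) by (simp add: A_def)
    moreover have "tail G e \<in> A \<longleftrightarrow> head G e \<in> A" if "e \<in> arcs G" for e
      using that arc[OF that] M.reachable_adj_trans by (auto simp: A_def)
    ultimately show ?R using uv(2) by (intro exI[of _ A]) (auto simp: A_def)
  next
    assume ?R
    then obtain A u v where A: "A \<subseteq> verts G" "u \<in> A" "v \<in> verts G" "v \<notin> A"
      "\<And>e. e \<in> arcs G \<Longrightarrow> tail G e \<in> A \<longleftrightarrow> head G e \<in> A"
      by blast
    have "w \<in> A" if "u \<rightarrow>\<^sup>*\<^bsub>mk_symmetric G\<^esub> w" for w
      using that
    proof (induction rule: M.reachable_induct)
      case (step x y)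
      then show ?case using A(5) by (auto simp: mk_symmetric_def)
    qed (use A(2) in simp)
    then show "\<not> connected G"
      using A by (auto simp: connected_def strongly_connected_def mk_symmetric_def)
  }
qed

lemma (in pair_graph) connectedD_cut:
  assumes "connected G" and "pverts G = A \<union> B" "A \<inter> B = {}" "A \<noteq> {}" "B \<noteq> {}"
  obtains u v where "u \<in> A" "v \<in> B" "(u, v) \<in> parcs G"
proof -
  have "\<not> (\<forall>e\<in>parcs G. fst e \<in> A \<longleftrightarrow> snd e \<in> A)"
    using not_connected_iff assms by fastforce
  then obtain u v where "(u, v) \<in> parcs G" "(u \<in> A) \<noteq> (v \<in> A)"
    by (metis surjective_pairing)
  then show ?thesis
    using that[of u v] that[of v u] assms(2) wellformed'[of u v] arcs_symmetric[of u v]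
    by (cases "u \<in> A") auto
qed

text \<open>A closed set and its complement in the remaining graph form the two sides; by symmetry
  it is enough to forbid arcs in one direction. \<open>S = pverts G\<close> satisfies neither side,
  since \<open>A\<close> is nonempty.\<close>

lemma (in pair_graph) disconnecting_set_iff:
  "disconnecting_set G S \<longleftrightarrow> S \<subseteq> pverts G \<and>
    (\<exists>A B. pverts G - S = A \<union> B \<and> A \<inter> B = {} \<and> A \<noteq> {} \<and> B \<noteq> {} \<and> (\<forall>u\<in>A. \<forall>v\<in>B. (u, v) \<notin> parcs G))"
    (is "_ \<longleftrightarrow> _ \<and> ?R")
proof (cases "S \<subset> pverts G")
  case True
  interpret H: wf_digraph "with_proj G \<restriction> (pverts G - S)" by (rule wellformed_induce_subgraph)
  have ne: "verts (with_proj G \<restriction> (pverts G - S)) \<noteq> {}" using True by auto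
  have "\<not> connected (with_proj G \<restriction> (pverts G - S)) \<longleftrightarrow> ?R"
    unfolding H.not_connected_iff[OF ne]
  proof
    assume "\<exists>A\<subseteq>verts (with_proj G \<restriction> (pverts G - S)).
        A \<noteq> {} \<and> A \<noteq> verts (with_proj G \<restriction> (pverts G - S)) \<and>
        (\<forall>e\<in>arcs (with_proj G \<restriction> (pverts G - S)).
          tail (with_proj G \<restriction> (pverts G - S)) e \<in> A \<longleftrightarrow>
          head (with_proj G \<restriction> (pverts G - S)) e \<in> A)"
    then obtain A where "A \<subseteq> pverts G - S" "A \<noteq> {}" "A \<noteq> pverts G - S"
      "\<forall>e\<in>{e \<in> parcs G. fst e \<in> pverts G - S \<and> snd e \<in> pverts G - S}. fst e \<in> A \<longleftrightarrow> snd e \<in> A"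
      by auto
    then show ?R by (intro exI[of _ A] exI[of _ "pverts G - S - A"]) fastforce
  next
    assume ?R
    then obtain A B where AB: "pverts G - S = A \<union> B" "A \<inter> B = {}" "A \<noteq> {}" "B \<noteq> {}"
      "\<forall>u\<in>A. \<forall>v\<in>B. (u, v) \<notin> parcs G" by blast
    have "\<forall>u\<in>A. \<forall>v\<in>B. (v, u) \<notin> parcs G" using AB(5) arcs_symmetric by blast
    then show "\<exists>A\<subseteq>verts (with_proj G \<restriction> (pverts G - S)).
        A \<noteq> {} \<and> A \<noteq> verts (with_proj G \<restriction> (pverts G - S)) \<and>
        (\<forall>e\<in>arcs (with_proj G \<restriction> (pverts G - S)).
          tail (with_proj G \<restriction> (pverts G - S)) e \<in> A \<longleftrightarrow>
          head (with_proj G \<restriction> (pverts G - S)) e \<in> A)"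
      using AB by (intro exI[of _ A]) auto
  qed
  then show ?thesis using True by (auto simp: disconnecting_set_def)
qed (auto simp: disconnecting_set_def)

section \<open>Degrees and double counting\<close>

lemma (in pair_graph) out_degree_eq: "out_degree G v = card (parcs G `` {v})"
proof -
  have "out_arcs G v = Pair v ` (parcs G `` {v})" by (auto simp: out_arcs_def)
  then show ?thesis by (simp add: out_degree_def card_image inj_on_def)
qed

lemma (in pair_graph) neighbours_subset: "parcs G `` {v} \<subseteq> pverts G - {v}"
  using wellformed' no_loops' by blast

lemma (in pair_graph) finite_neighbours [simp]: "finite (parcs G `` {v})"
  using finite_subset[OF neighbours_subset] pair_finite_verts by blast

lemma (in pair_graph) min_degree_le:
  "v \<in> pverts G \<Longrightarrow> min_degree G \<le> card (parcs G `` {v})"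
  using pair_finite_verts by (auto simp: min_degree_def out_degree_eq)

lemma (in pair_graph) min_degree_attained:
  assumes "pverts G \<noteq> {}"
  obtains v where "v \<in> pverts G" "card (parcs G `` {v}) = min_degree G"
proof -
  have "min_degree G \<in> out_degree (with_proj G) ` pverts G"
    unfolding min_degree_def using pair_finite_verts assms by (intro Min_in) auto
  then show ?thesis using that by (auto simp: out_degree_eq)
qed

lemma (in pair_graph) card_parcs_eq: "card (parcs G) = (\<Sum>v\<in>pverts G. card (parcs G `` {v}))"
proof -
  have "parcs G = Sigma (pverts G) (\<lambda>v. parcs G `` {v})" using wellformed' by auto
  then have "card (parcs G) = card (Sigma (pverts G) (\<lambda>v. parcs G `` {v}))" by (rule arg_cong)
  also have "\<dots> = (\<Sum>v\<in>pverts G. card (parcs G `` {v}))"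
    using pair_finite_verts by (intro card_SigmaI) auto
  finally show ?thesis .
qed

text \<open>Both sides run over all arcs, and reversing arcs permutes them. This is the symmetry of
  the adjacency matrix, used to trade row sums for column sums.\<close>

lemma (in pair_graph) sum_neighbours_swap:
  fixes f :: "'a \<Rightarrow> 'a \<Rightarrow> 'b :: comm_monoid_add"
  shows "(\<Sum>v\<in>pverts G. \<Sum>u\<in>parcs G `` {v}. f v u) = (\<Sum>u\<in>pverts G. \<Sum>v\<in>parcs G `` {u}. f v u)"
proof -
  have "(\<Sum>v\<in>pverts G. \<Sum>u\<in>parcs G `` {v}. f v u) =
      (\<Sum>v\<in>pverts G. \<Sum>u\<in>{u \<in> pverts G. (v, u) \<in> parcs G}. f v u)"
    using wellformed' by (intro sum.cong) auto
  also have "\<dots> = (\<Sum>u\<in>pverts G. \<Sum>v\<in>{v \<in> pverts G. (v, u) \<in> parcs G}. f v u)"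
    using pair_finite_verts by (rule sum.swap_restrict) (rule pair_finite_verts)
  also have "\<dots> = (\<Sum>u\<in>pverts G. \<Sum>v\<in>parcs G `` {u}. f v u)"
    using wellformed' arcs_symmetric by (intro sum.cong) auto
  finally show ?thesis .
qed

section \<open>Vertex-connectivity against minimum degree\<close>

text \<open>Removing the neighbours of \<open>v\<close> isolates it; the bound on the degree says
  that another vertex survives.\<close>

lemma (in pair_graph) disconnecting_neighbours:
  assumes "v \<in> pverts G" "Suc (card (parcs G `` {v})) < card (pverts G)"
  shows "disconnecting_set G (parcs G `` {v})"
proof -
  have "card (insert v (parcs G `` {v})) < card (pverts G)"
    using assms(2) le_less_trans[OF card_insert_le_m1] by (simp add: card_insert_if)
  moreover have "insert v (parcs G `` {v}) \<subseteq> pverts G" using assms(1) neighbours_subset by blast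
  ultimately have "pverts G - insert v (parcs G `` {v}) \<noteq> {}"
    by (metis Diff_eq_empty_iff less_irrefl subset_antisym)
  then show ?thesis
    unfolding disconnecting_set_iff using neighbours_subset[of v] assms(1)
    by (intro conjI exI[of _ "{v}"] exI[of _ "pverts G - insert v (parcs G `` {v})"]) auto
qed

lemma (in pair_graph) vertex_connectivity_complete:
  assumes "complete_digraph (card (pverts G)) (with_proj G)" and "pverts G \<noteq> {}"
  shows "vertex_connectivity G = min_degree G"
proof -
  obtain v where v: "v \<in> pverts G" "card (parcs G `` {v}) = min_degree G"
    using min_degree_attained[OF assms(2)] .
  have "parcs G = {(u, v). (u, v) \<in> pverts G \<times> pverts G \<and> u \<noteq> v}"
    using assms(1) by (simp add: complete_digraph_pair_def)
  then have "parcs G `` {v} = pverts G - {v}" using v(1) by auto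
  then show ?thesis using assms(1) v by (simp add: vertex_connectivity_def)
qed

text \<open>An endpoint of a non-adjacent pair misses itself and the other endpoint.\<close>

lemma (in pair_graph) min_degree_less_if_not_complete:
  assumes "\<not> complete_digraph (card (pverts G)) (with_proj G)"
  shows "Suc (min_degree G) < card (pverts G)"
proof -
  have "parcs G \<noteq> {(u, v). (u, v) \<in> pverts G \<times> pverts G \<and> u \<noteq> v}"
    using assms pair_finite_verts by (simp add: complete_digraph_pair_def)
  then obtain u v where uv: "u \<in> pverts G" "v \<in> pverts G" "u \<noteq> v" "(u, v) \<notin> parcs G"
    using wellformed' no_loops' by blast
  have "parcs G `` {u} \<subseteq> pverts G - {u, v}" using uv neighbours_subset[of u] by blast
  then have "card (parcs G `` {u}) \<le> card (pverts G - {u, v})"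
    using pair_finite_verts by (intro card_mono) auto
  also have "\<dots> = card (pverts G) - 2" using uv by (simp add: card_Diff_subset)
  finally have "card (parcs G `` {u}) \<le> card (pverts G) - 2" .
  moreover have "card {u, v} \<le> card (pverts G)" using uv pair_finite_verts by (intro card_mono) auto
  ultimately have "card (parcs G `` {u}) + 2 \<le> card (pverts G)" using uv(3) by simp
  then show ?thesis using min_degree_le[OF uv(1)] by linarith
qed

lemma (in pair_graph) vertex_connectivity_le_min_degree:
  assumes "pverts G \<noteq> {}"
  shows "vertex_connectivity G \<le> min_degree G"
proof (cases "complete_digraph (card (pverts G)) (with_proj G)")
  case False
  obtain v where v: "v \<in> pverts G" "card (parcs G `` {v}) = min_degree G"
    using min_degree_attained[OF assms] .
  have "{S. disconnecting_set G S} \<subseteq> Pow (pverts G)" by (auto simp: disconnecting_set_def)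
  then have "finite {S. disconnecting_set G S}"
    using pair_finite_verts finite_subset by blast
  then have "vertex_connectivity G \<le> card (parcs G `` {v})"
    using False disconnecting_neighbours[OF v(1)] min_degree_less_if_not_complete[OF False] v(2)
    by (auto simp: vertex_connectivity_def intro!: Min_le intro: image_eqI[of _ _ "parcs G `` {v}"])
  then show ?thesis using v(2) by simp
qed (simp add: vertex_connectivity_complete assms)

text \<open>The \<open>Min\<close> in the definition is attained only over a finite nonempty set;
  the neighbourhood of a vertex of minimum degree shows that some disconnecting set exists.\<close>

lemma (in pair_graph) minimum_disconnecting_set:
  assumes "\<not> complete_digraph (card (pverts G)) (with_proj G)"
  obtains S where "disconnecting_set G S" "card S = vertex_connectivity G"
proof -
  have "pverts G \<noteq> {}" using min_degree_less_if_not_complete[OF assms] by auto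
  then obtain v where v: "v \<in> pverts G" "card (parcs G `` {v}) = min_degree G"
    using min_degree_attained by blast
  have "disconnecting_set G (parcs G `` {v})"
    using disconnecting_neighbours v min_degree_less_if_not_complete[OF assms] by simp
  moreover have "{S. disconnecting_set G S} \<subseteq> Pow (pverts G)" by (auto simp: disconnecting_set_def)
  then have "finite {S. disconnecting_set G S}"
    using pair_finite_verts finite_subset by blast
  ultimately have "vertex_connectivity G \<in> card ` {S. disconnecting_set G S}"
    using assms by (auto simp: vertex_connectivity_def intro!: Min_in)
  then show ?thesis using that by auto
qed

section \<open>The spectral radius and vertex degrees\<close>

text \<open>A matrix of positive dimension has an eigenvalue whose modulus is the spectral radius.
  Taking moduli in its eigenvector equation and applying the triangle inequality leaves an
  inequality in each row.\<close>

lemma (in pair_graph) subinvariant_vector: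
  assumes "pverts G \<noteq> {}"
  obtains y :: "'a \<Rightarrow> real" where "\<And>v. y v \<ge> 0" "\<exists>v\<in>pverts G. y v > 0"
    "\<And>v. v \<in> pverts G \<Longrightarrow> graph_spectral_radius G * y v \<le> (\<Sum>u\<in>parcs G `` {v}. y u)"
proof -
  define vs where "vs = (SOME vs. distinct vs \<and> set vs = pverts G)"
  have "\<exists>vs. distinct vs \<and> set vs = pverts G"
    using finite_distinct_list[OF pair_finite_verts] by blast
  then have vs: "distinct vs \<and> set vs = pverts G" unfolding vs_def by (rule someI_ex)
  have "length vs > 0" using vs assms by auto
  moreover have "adjacency_mat G vs \<in> carrier_mat (length vs) (length vs)"
    by (simp add: adjacency_mat_def)
  ultimately have "spectral_radius (adjacency_mat G vs) \<in> norm ` spectrum (adjacency_mat G vs)"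
    by (intro spectral_radius_mem_max(1))
  then obtain k where k: "eigenvalue (adjacency_mat G vs) k" "norm k = graph_spectral_radius G"
    by (auto simp: spectrum_def graph_spectral_radius_def vs_def)
  then obtain f where f: "\<exists>v\<in>pverts G. f v \<noteq> 0"
    "\<And>v. v \<in> pverts G \<Longrightarrow> (\<Sum>u | u \<in> pverts G \<and> (v, u) \<in> parcs G. f u) = k * f v"
    using eigenvalue_adjacency_mat[of vs G k] vs by blast
  show ?thesis
  proof (rule that[of "\<lambda>v. norm (f v)"])
    fix v assume v: "v \<in> pverts G"
    have "{u. u \<in> pverts G \<and> (v, u) \<in> parcs G} = parcs G `` {v}" using wellformed' by auto
    then have "k * f v = (\<Sum>u\<in>parcs G `` {v}. f u)" using f(2)[OF v] by simp
    then have "norm k * norm (f v) = norm (\<Sum>u\<in>parcs G `` {v}. f u)" by (metis norm_mult)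
    also have "\<dots> \<le> (\<Sum>u\<in>parcs G `` {v}. norm (f u))" by (rule norm_sum)
    finally show "graph_spectral_radius G * norm (f v) \<le> (\<Sum>u\<in>parcs G `` {v}. norm (f u))"
      using k(2) by simp
  qed (use f(1) in auto)
qed

text \<open>
  Both sides come from evaluating the entry sum of \<open>(A\<^sup>2 - (\<delta> - 1) A) y\<close>, once by applying the
  matrix to \<open>y\<close> and once by taking its column sums.  If \<open>r \<ge> \<delta>\<close> and \<open>A y \<ge> r y \<ge> 0\<close>, all terms on
  the right are nonnegative, which gives the bound on \<open>r\<close> together with its equality case.
\<close>

lemma (in pair_graph) quadratic_degree_identity:
  fixes y :: "'a \<Rightarrow> real" and r \<delta> :: real
  defines "d \<equiv> \<lambda>v. real (card (parcs G `` {v}))"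
  shows "(real (card (parcs G)) - (real (card (pverts G)) - 1) * \<delta> - r * (r - \<delta> + 1)) * (\<Sum>v\<in>pverts G. y v) =
    (\<Sum>v\<in>pverts G. y v * (\<Sum>u\<in>pverts G - insert v (parcs G `` {v}). d u - \<delta>)) +
    (\<Sum>v\<in>pverts G. (r - \<delta> + 1 + d v) * ((\<Sum>u\<in>parcs G `` {v}. y u) - r * y v))"
proof -
  let ?V = "pverts G" and ?N = "\<lambda>v. parcs G `` {v}"
  let ?M = "real (card (parcs G))" and ?n = "real (card ?V)"
  define w where "w v = (\<Sum>u\<in>?V - insert v (?N v). d u - \<delta>)" for v
  define Ay where "Ay v = (\<Sum>u\<in>?N v. y u)" for v
  \<comment> \<open>All degrees add up to \<open>?M\<close>. Subtract \<open>d v\<close> and the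
    degrees of the \<open>?n - 1 - d v\<close> non-neighbours, whose total excess over \<delta> is
    \<open>w v\<close>.\<close>
  have row: "(\<Sum>u\<in>?N v. d u) = ?M - (?n - 1) * \<delta> - w v + (\<delta> - 1) * d v" if v: "v \<in> ?V" for v
  proof -
    have sub: "insert v (?N v) \<subseteq> ?V" using v neighbours_subset by blast
    have notin: "v \<notin> ?N v" using neighbours_subset by blast
    have "?M = (\<Sum>u\<in>?V. d u)" by (simp add: card_parcs_eq d_def)
    also have "\<dots> = (\<Sum>u\<in>?V - insert v (?N v). d u) + (\<Sum>u\<in>insert v (?N v). d u)"
      using sub pair_finite_verts by (rule sum.subset_diff)
    finally have M: "?M = (\<Sum>u\<in>?V - insert v (?N v). d u) + d v + (\<Sum>u\<in>?N v. d u)"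
      using notin by simp
    have "card (insert v (?N v)) \<le> card ?V" using sub pair_finite_verts by (rule card_mono[rotated])
    then have "real (card (?V - insert v (?N v))) = ?n - 1 - d v"
      using sub notin by (simp add: card_Diff_subset d_def)
    then have "w v = (\<Sum>u\<in>?V - insert v (?N v). d u) - (?n - 1 - d v) * \<delta>"
      by (simp add: w_def sum_subtractf)
    then show ?thesis using M by (simp add: algebra_simps)
  qed
  have sum_Ay: "(\<Sum>v\<in>?V. Ay v) = (\<Sum>v\<in>?V. d v * y v)"
    unfolding Ay_def by (subst sum_neighbours_swap) (simp add: d_def)
  have "(\<Sum>v\<in>?V. d v * Ay v) = (\<Sum>v\<in>?V. \<Sum>u\<in>?N v. d v * y u)"
    by (simp add: Ay_def sum_distrib_left)
  also have "\<dots> = (\<Sum>v\<in>?V. y v * (\<Sum>u\<in>?N v. d u))"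
    by (subst sum_neighbours_swap) (simp add: sum_distrib_left mult.commute)
  also have "\<dots> = (\<Sum>v\<in>?V. (?M - (?n - 1) * \<delta>) * y v - y v * w v + (\<delta> - 1) * (d v * y v))"
    by (intro sum.cong refl) (simp add: row algebra_simps)
  also have "\<dots> = (?M - (?n - 1) * \<delta>) * (\<Sum>v\<in>?V. y v) - (\<Sum>v\<in>?V. y v * w v)
      + (\<delta> - 1) * (\<Sum>v\<in>?V. d v * y v)"
    by (simp add: sum.distrib sum_subtractf sum_distrib_left)
  finally have dAy: "(\<Sum>v\<in>?V. d v * Ay v) = \<dots>" .
  have "(\<Sum>v\<in>?V. (r - \<delta> + 1 + d v) * (Ay v - r * y v)) =
      (\<Sum>v\<in>?V. (r - \<delta> + 1) * Ay v + d v * Ay v - (r * (r - \<delta> + 1)) * y v - r * (d v * y v))"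
    by (intro sum.cong refl) (simp add: algebra_simps)
  also have "\<dots> = (r - \<delta> + 1) * (\<Sum>v\<in>?V. Ay v) + (\<Sum>v\<in>?V. d v * Ay v)
      - (r * (r - \<delta> + 1)) * (\<Sum>v\<in>?V. y v) - r * (\<Sum>v\<in>?V. d v * y v)"
    by (simp add: sum.distrib sum_subtractf sum_distrib_left)
  finally have "(\<Sum>v\<in>?V. (r - \<delta> + 1 + d v) * (Ay v - r * y v)) = \<dots>" .
  then show ?thesis
    unfolding w_def[symmetric] Ay_def[symmetric] using dAy sum_Ay by (simp add: algebra_simps)
qed

section \<open>Recognising the exceptional graph\<close>

lemma digraph_isoI_pair:
  assumes "pair_graph G" and "inj_on h (pverts G)" and "pverts H = h ` pverts G"
    and "parcs H = map_prod h h ` parcs G"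
  shows "digraph_iso (with_proj G) (with_proj H)"
proof -
  interpret pair_graph G by fact
  let ?f = "\<lparr> iso_verts = h, iso_arcs = map_prod h h, iso_head = snd, iso_tail = fst \<rparr>"
  have "parcs G \<subseteq> pverts G \<times> pverts G" using wellformed' by auto
  then have "inj_on (map_prod h h) (parcs G)"
    using map_prod_inj_on[OF assms(2) assms(2)] inj_on_subset by blast
  then have "digraph_isomorphism ?f"
    using assms(2) wf_digraph by (auto simp: digraph_isomorphism_def)
  moreover have "with_proj H = app_iso ?f (with_proj G)"
    using assms(3,4) by (simp add: app_iso_def with_proj_def)
  ultimately show ?thesis unfolding digraph_iso_def by blast
qed

lemma complete_graph_simps [simp]:
  "pverts (complete_graph m) = {..<m}"
  "(u, v) \<in> parcs (complete_graph m) \<longleftrightarrow> u < m \<and> v < m \<and> u \<noteq> v"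
  by (auto simp: complete_graph_def)

lemma disjoint_union_simps [simp]:
  "pverts (disjoint_union G H) = pverts G <+> pverts H"
  "(Inl u, Inl v) \<in> parcs (disjoint_union G H) \<longleftrightarrow> (u, v) \<in> parcs G"
  "(Inl u, Inr w) \<notin> parcs (disjoint_union G H)"
  "(Inr w, Inl u) \<notin> parcs (disjoint_union G H)"
  "(Inr w, Inr x) \<in> parcs (disjoint_union G H) \<longleftrightarrow> (w, x) \<in> parcs H"
  by (auto simp: disjoint_union_def image_iff Bex_def)

lemma graph_join_simps [simp]:
  "pverts (graph_join G H) = pverts G <+> pverts H"
  "(Inl u, Inl v) \<in> parcs (graph_join G H) \<longleftrightarrow> (u, v) \<in> parcs G"
  "(Inl u, Inr w) \<in> parcs (graph_join G H) \<longleftrightarrow> u \<in> pverts G \<and> w \<in> pverts H"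
  "(Inr w, Inl u) \<in> parcs (graph_join G H) \<longleftrightarrow> u \<in> pverts G \<and> w \<in> pverts H"
  "(Inr w, Inr x) \<in> parcs (graph_join G H) \<longleftrightarrow> (w, x) \<in> parcs H"
  by (auto simp: graph_join_def)

text \<open>Describing the arcs by what is missing gives the join the same form as a graph with all
  arcs except those between \<open>A\<close> and \<open>B\<close>.\<close>

lemma parcs_join_of_disjoint_union:
  fixes k a b :: nat
  defines "H \<equiv> graph_join (complete_graph k) (disjoint_union (complete_graph a) (complete_graph b))"
  shows "parcs H = pverts H \<times> pverts H -
    (Id \<union> Inr ` Inl ` {..<a} \<times> Inr ` Inr ` {..<b} \<union> Inr ` Inr ` {..<b} \<times> Inr ` Inl ` {..<a})"
    (is "_ = ?R")
proof -
  have "(x, y) \<in> parcs H \<longleftrightarrow> (x, y) \<in> ?R" for x y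
    apply (cases x; cases y; hypsubst)
    subgoal by (auto simp: H_def)
    subgoal by (auto simp: H_def)
    subgoal by (auto simp: H_def)
    subgoal for p q by (cases p; cases q; hypsubst) (auto simp: H_def)
    done
  then show ?thesis by (intro equalityI subrelI) (simp_all only:)
qed

text \<open>Arbitrary bijections of \<open>S\<close>, \<open>A\<close> and \<open>B\<close> onto
  initial segments glue to an isomorphism: the arcs depend on the blocks alone, and the image under
  an injective map preserves the set difference.\<close>

lemma join_of_disjoint_union_iso:
  assumes "pair_graph G" and V: "pverts G = S \<union> (A \<union> B)"
    and disj: "S \<inter> A = {}" "S \<inter> B = {}" "A \<inter> B = {}"
    and E: "parcs G = pverts G \<times> pverts G - (Id \<union> A \<times> B \<union> B \<times> A)"
  shows "digraph_iso (with_proj G)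
    (with_proj (graph_join (complete_graph (card S))
      (disjoint_union (complete_graph (card A)) (complete_graph (card B)))))"
proof -
  interpret pair_graph G by fact
  have fin: "finite S" "finite A" "finite B" using pair_finite_verts V by auto
  obtain f where f: "bij_betw f S {..<card S}"
    using ex_bij_betw_finite_nat[OF fin(1)] by (auto simp: atLeast0LessThan)
  obtain g where g: "bij_betw g A {..<card A}"
    using ex_bij_betw_finite_nat[OF fin(2)] by (auto simp: atLeast0LessThan)
  obtain k where k: "bij_betw k B {..<card B}"
    using ex_bij_betw_finite_nat[OF fin(3)] by (auto simp: atLeast0LessThan)
  define h where "h v = (if v \<in> S then Inl (f v) else if v \<in> A then Inr (Inl (g v)) else Inr (Inr (k v)))" for v
  have inj: "inj_on h (pverts G)"
    unfolding V using f g k by (auto simp: inj_on_def h_def bij_betw_def)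
  have hS: "h ` S = Inl ` {..<card S}"
  proof -
    have "h ` S = (\<lambda>v. Inl (f v)) ` S" by (intro image_cong) (auto simp: h_def)
    also have "\<dots> = Inl ` f ` S" by (simp only: image_image)
    finally show ?thesis using f by (simp add: bij_betw_def)
  qed
  have hA: "h ` A = Inr ` Inl ` {..<card A}"
  proof -
    have "h ` A = (\<lambda>v. Inr (Inl (g v))) ` A" using disj by (intro image_cong) (auto simp: h_def)
    also have "\<dots> = Inr ` Inl ` g ` A" by (simp only: image_image)
    finally show ?thesis using g by (simp add: bij_betw_def)
  qed
  have hB: "h ` B = Inr ` Inr ` {..<card B}"
  proof -
    have "h ` B = (\<lambda>v. Inr (Inr (k v))) ` B" using disj by (intro image_cong) (auto simp: h_def)
    also have "\<dots> = Inr ` Inr ` k ` B" by (simp only: image_image)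
    finally show ?thesis using k by (simp add: bij_betw_def)
  qed
  let ?H = "graph_join (complete_graph (card S))
      (disjoint_union (complete_graph (card A)) (complete_graph (card B)))"
  have VH: "pverts ?H = h ` pverts G"
    unfolding V image_Un hS hA hB by (simp add: Plus_def image_Un)
  have EH: "parcs ?H = pverts ?H \<times> pverts ?H - (Id \<union> h ` A \<times> h ` B \<union> h ` B \<times> h ` A)"
    using parcs_join_of_disjoint_union[of "card S" "card A" "card B"] by (simp only: hA hB)
  have "map_prod h h ` parcs G = h ` pverts G \<times> h ` pverts G - (Id \<union> h ` A \<times> h ` B \<union> h ` B \<times> h ` A)"
  proof -
    have hin: "h u \<in> h ` X \<longleftrightarrow> u \<in> X" if "u \<in> pverts G" "X \<subseteq> pverts G" for u X
      using that inj by (meson inj_on_image_mem_iff)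
    have heq: "h u = h v \<longleftrightarrow> u = v" if "u \<in> pverts G" "v \<in> pverts G" for u v
      using that inj by (meson inj_on_eq_iff)
    have sub: "A \<subseteq> pverts G" "B \<subseteq> pverts G" using V by auto
    show ?thesis
    proof (intro equalityI subrelI)
      fix x y assume "(x, y) \<in> map_prod h h ` parcs G"
      then obtain u v where uv: "(u, v) \<in> parcs G" "x = h u" "y = h v" by auto
      then have "u \<in> pverts G" "v \<in> pverts G" using wellformed' by blast+
      then show "(x, y) \<in> h ` pverts G \<times> h ` pverts G - (Id \<union> h ` A \<times> h ` B \<union> h ` B \<times> h ` A)"
        using uv hin sub heq by (simp add: E)
    next
      fix x y assume "(x, y) \<in> h ` pverts G \<times> h ` pverts G - (Id \<union> h ` A \<times> h ` B \<union> h ` B \<times> h ` A)"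
      then obtain u v where uv: "u \<in> pverts G" "v \<in> pverts G" "x = h u" "y = h v"
        and "(h u, h v) \<notin> Id \<union> h ` A \<times> h ` B \<union> h ` B \<times> h ` A" by blast
      then have "(u, v) \<in> parcs G" using hin sub heq by (simp add: E)
      then show "(x, y) \<in> map_prod h h ` parcs G" using uv(3,4) by force
    qed
  qed
  then show ?thesis
    using digraph_isoI_pair[OF assms(1) inj VH] EH unfolding VH by simp
qed

section \<open>Arcs and degrees in the presence of a cut\<close>

lemma (in pair_graph) parcs_subset_cut:
  assumes "\<forall>u\<in>A. \<forall>v\<in>B. (u, v) \<notin> parcs G"
  shows "parcs G \<subseteq> pverts G \<times> pverts G - (Id \<union> A \<times> B \<union> B \<times> A)"
proof (rule subrelI)
  fix u v assume uv: "(u, v) \<in> parcs G"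
  then show "(u, v) \<in> pverts G \<times> pverts G - (Id \<union> A \<times> B \<union> B \<times> A)"
    using assms wellformed'[OF uv] no_loops'[OF uv] arcs_symmetric[OF uv] by blast
qed

text \<open>The removed pairs split into the diagonal and two disjoint rectangles. The additive form
  avoids truncated subtraction.\<close>

lemma card_pairs_cut:
  assumes "finite V" "A \<subseteq> V" "B \<subseteq> V" "A \<inter> B = {}"
  shows "card (V \<times> V - (Id \<union> A \<times> B \<union> B \<times> A)) + card V + 2 * card A * card B = card V * card V"
proof -
  have fin: "finite A" "finite B" using assms by (auto intro: finite_subset)
  have "V \<times> V - (Id \<union> A \<times> B \<union> B \<times> A) = V \<times> V - (Id_on V \<union> (A \<times> B \<union> B \<times> A))" by auto
  moreover have "card (V \<times> V - (Id_on V \<union> (A \<times> B \<union> B \<times> A))) =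
      card (V \<times> V) - card (Id_on V \<union> (A \<times> B \<union> B \<times> A))"
    using assms fin by (intro card_Diff_subset) (auto simp: Id_on_def)
  moreover have "card (Id_on V \<union> (A \<times> B \<union> B \<times> A)) \<le> card (V \<times> V)"
    using assms fin by (intro card_mono) auto
  moreover have "card (Id_on V \<union> (A \<times> B \<union> B \<times> A)) = card (Id_on V) + card (A \<times> B \<union> B \<times> A)"
    using assms fin by (intro card_Un_disjoint) (auto simp: Id_on_def)
  moreover have "card (A \<times> B \<union> B \<times> A) = card (A \<times> B) + card (B \<times> A)"
    using assms fin by (intro card_Un_disjoint) auto
  moreover have "card (Id_on V) = card V"
    using assms(1) by (simp add: Id_on_def card_UN_disjoint)
  ultimately show ?thesis by (simp add: card_cartesian_product)
qed

text \<open>A vertex of \<open>A\<close> has all its neighbours in \<open>S\<close> and the rest of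
  \<open>A\<close>.\<close>

lemma (in pair_graph) min_degree_less_cut:
  assumes "pverts G = S \<union> (A \<union> B)" "A \<noteq> {}" "\<forall>u\<in>A. \<forall>v\<in>B. (u, v) \<notin> parcs G"
  shows "min_degree G < card S + card A"
proof -
  have fin: "finite S" "finite A" using assms(1) pair_finite_verts by auto
  obtain a where a: "a \<in> A" using assms(2) by blast
  have "parcs G `` {a} \<subseteq> S \<union> (A - {a})" using a assms(1,3) neighbours_subset[of a] by auto
  then have "card (parcs G `` {a}) \<le> card (S \<union> (A - {a}))" using fin by (intro card_mono) auto
  also have "\<dots> \<le> card S + card (A - {a})" by (rule card_Un_le)
  also have "\<dots> < card S + card A" using a fin by (intro add_strict_left_mono card_Diff1_less)
  finally show ?thesis using min_degree_le[of a] a assms(1) by auto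
qed

section \<open>Two real inequalities\<close>

text \<open>The difference of the two sides is
  \<open>(a - s) * (b - s) + (s - 2) * (a + b - s)\<close>.\<close>

lemma cut_product_ge:
  fixes a b s :: real
  assumes "2 \<le> s" "s \<le> a" "s \<le> b"
  shows "2 * (a + b - s) \<le> a * b"
proof -
  have "0 \<le> (a - s) * (b - s) + (s - 2) * (a + b - s)"
    using assms by (intro add_nonneg_nonneg mult_nonneg_nonneg) auto
  then show ?thesis by (simp add: algebra_simps)
qed

text \<open>The lower bound on \<open>r\<close> is the larger root of
  \<open>x * (x - p + 1) = q + p\<close>.\<close>

lemma quadratic_ge_if_root_le:
  fixes r p q :: real
  assumes "r \<ge> (p - 1) / 2 + sqrt (q + (p + 1)\<^sup>2 / 4)" "q \<ge> 0" "p \<ge> 0"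
  shows "r \<ge> p" "r * (r - p + 1) \<ge> q + p"
proof -
  define s where "s = sqrt (q + (p + 1)\<^sup>2 / 4)"
  have rs: "r \<ge> (p - 1) / 2 + s" using assms(1) by (simp add: s_def)
  have "((p + 1) / 2)\<^sup>2 \<le> q + (p + 1)\<^sup>2 / 4" using assms by (simp add: power_divide)
  then have s: "(p + 1) / 2 \<le> s" unfolding s_def by (rule real_le_rsqrt)
  with rs show "r \<ge> p" by (simp add: field_simps)
  have "s\<^sup>2 = q + (p + 1)\<^sup>2 / 4" using assms(2) by (simp add: s_def)
  moreover have "s\<^sup>2 \<le> (r - (p - 1) / 2)\<^sup>2"
    using rs s assms(3) by (intro power_mono) auto
  ultimately have "q + (p + 1)\<^sup>2 / 4 \<le> (r - (p - 1) / 2)\<^sup>2" by simp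
  then show "r * (r - p + 1) \<ge> q + p" by (simp add: power2_eq_square field_simps)
qed

section \<open>Equality throughout when \<kappa> < \<delta>\<close>

theorem theorem3p2:
  fixes G :: "'a pair_pre_digraph" and n \<delta> \<kappa> :: nat
  assumes "pair_graph G"
    and "Digraph_Component.connected (with_proj G)"
    and "card (pverts G) = n" and "n \<ge> 5"
    and "min_degree G = \<delta>" and "\<delta> \<ge> 2"
    and "vertex_connectivity G = \<kappa>"
    and "graph_spectral_radius G \<ge>
      (real \<delta> - 1) / 2 +
      sqrt ((real n - real \<delta> - 1) * (real n - 4) + (real \<delta> + 1)\<^sup>2 / 4)"
  shows "\<kappa> = \<delta> \<or>
    digraph_iso (with_proj G)
      (with_proj (graph_join (complete_graph (n - 4))
        (disjoint_union (complete_graph 2) (complete_graph 2))))"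
proof (cases "\<kappa> = \<delta>")
  case False
  interpret pair_graph G by fact
  let ?V = "pverts G" and ?N = "\<lambda>v. parcs G `` {v}"
  define r where "r = graph_spectral_radius G"
  have ne: "?V \<noteq> {}" using assms(3,4) by auto
  have nc: "\<not> complete_digraph (card ?V) (with_proj G)"
    using vertex_connectivity_complete[OF _ ne] False assms(5,7) by auto
  have \<kappa>_less: "\<kappa> < \<delta>"
    using vertex_connectivity_le_min_degree[OF ne] False assms(5,7) by linarith
  have \<delta>_less: "Suc \<delta> < n" using min_degree_less_if_not_complete[OF nc] assms(3,5) by simp
  obtain S where S: "disconnecting_set G S" "card S = \<kappa>"
    using minimum_disconnecting_set[OF nc] assms(7) by auto
  then obtain A B where "S \<subseteq> ?V" "?V - S = A \<union> B" and disj: "A \<inter> B = {}"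
    and AB: "A \<noteq> {}" "B \<noteq> {}" "\<forall>u\<in>A. \<forall>v\<in>B. (u, v) \<notin> parcs G"
    unfolding disconnecting_set_iff by blast
  then have V: "?V = S \<union> (A \<union> B)" and SAB: "S \<inter> A = {}" "S \<inter> B = {}" by blast+
  have BA: "\<forall>u\<in>B. \<forall>v\<in>A. (u, v) \<notin> parcs G" using AB(3) arcs_symmetric by blast
  have fin: "finite S" "finite A" "finite B" using V pair_finite_verts by auto
  define a b where "a = card A" and "b = card B"
  have n: "n = \<kappa> + a + b"
    using assms(3) S(2) SAB disj fin unfolding V by (simp add: card_Un_disjoint Int_Un_distrib a_def b_def)
  have a: "\<delta> < \<kappa> + a"
    using min_degree_less_cut[OF V AB(1,3)] S(2) assms(5) by (simp add: a_def)
  have V': "?V = S \<union> (B \<union> A)" using V by blast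
  have b: "\<delta> < \<kappa> + b"
    using min_degree_less_cut[OF V' AB(2) BA] S(2) assms(5) by (simp add: b_def)

  \<comment> \<open>A vertex of the cut is needed below: once all permitted arcs are present, it is
    adjacent to every other vertex.\<close>
  have "S \<noteq> {}"
  proof
    assume "S = {}"
    then obtain u v where "u \<in> A" "v \<in> B" "(u, v) \<in> parcs G"
      using connectedD_cut[OF assms(2), of A B] V disj AB(1,2) by auto
    then show False using AB(3) by blast
  qed
  then obtain s where s: "s \<in> S" by blast

  let ?F = "?V \<times> ?V - (Id \<union> A \<times> B \<union> B \<times> A)"
  have EF: "parcs G \<subseteq> ?F" using parcs_subset_cut[OF AB(3)] .
  have finF: "finite ?F" using pair_finite_verts by simp
  have "A \<subseteq> ?V" "B \<subseteq> ?V" using V by auto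
  then have "card ?F + n + 2 * a * b = n * n"
    using card_pairs_cut[OF pair_finite_verts _ _ disj] assms(3) by (simp add: a_def b_def)
  then have cF: "real (card ?F) = real n * real n - real n - 2 * (real a * real b)"
    by (simp flip: of_nat_mult of_nat_add)
  have cE: "card (parcs G) \<le> card ?F" using card_mono[OF finF EF] .
  define q where "q = (real n - real \<delta> - 1) * (real n - 4)"
  \<comment> \<open>With \<open>s = \<delta> + 1 - \<kappa>\<close>, which is at least 2, the
    quantity \<open>a + b - s\<close> equals \<open>n - \<delta> - 1\<close>.\<close>
  have ab: "2 * (real n - real \<delta> - 1) \<le> real a * real b"
    using cut_product_ge[of "real \<delta> + 1 - real \<kappa>" "real a" "real b"] a b \<kappa>_less n by simp
  have qF: "real (card ?F) - (real n - 1) * real \<delta> \<le> q + real \<delta>"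
    using ab cF by (simp add: q_def algebra_simps)
  have "q \<ge> 0" unfolding q_def using \<delta>_less assms(4) by (intro mult_nonneg_nonneg) auto
  then have r: "r \<ge> real \<delta>" "r * (r - real \<delta> + 1) \<ge> q + real \<delta>"
    using quadratic_ge_if_root_le[of "real \<delta>" q r] assms(8) by (auto simp: q_def r_def)

  obtain y :: "'a \<Rightarrow> real" where y: "\<And>v. y v \<ge> 0" "\<exists>v\<in>?V. y v > 0"
    "\<And>v. v \<in> ?V \<Longrightarrow> r * y v \<le> (\<Sum>u\<in>?N v. y u)"
    using subinvariant_vector[OF ne] unfolding r_def by blast
  have sum_y: "(\<Sum>v\<in>?V. y v) > 0"
    using y(1,2) pair_finite_verts by (metis sum_pos2)
  define w where "w v = (\<Sum>u\<in>?V - insert v (?N v). real (card (?N u)) - real \<delta>)" for v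
  define p where "p v = (r - real \<delta> + 1 + real (card (?N v))) * ((\<Sum>u\<in>?N v. y u) - r * y v)" for v
  have w: "w v \<ge> 0" for v
    unfolding w_def using min_degree_le assms(5) by (intro sum_nonneg) auto
  have p: "p v \<ge> 0" if "v \<in> ?V" for v
    unfolding p_def using r(1) y(3)[OF that] by (intro mult_nonneg_nonneg) auto
  \<comment> \<open>\<open>c\<close> is the coefficient on the left of the degree identity. It is at
    most 0 by the edge count and the hypothesis on \<rho>, whereas the right side is nonnegative;
    hence \<open>c = 0\<close> and every term on the right vanishes.\<close>
  define c where "c = real (card (parcs G)) - (real n - 1) * real \<delta> - r * (r - real \<delta> + 1)"
  have c: "c \<le> real (card (parcs G)) - real (card ?F)" "c \<le> 0"
    "c = 0 \<Longrightarrow> real (card ?F) - (real n - 1) * real \<delta> = q + real \<delta>"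
    using qF r(2) cE unfolding c_def by linarith+
  have id: "c * (\<Sum>v\<in>?V. y v) = (\<Sum>v\<in>?V. y v * w v) + (\<Sum>v\<in>?V. p v)"
    using quadratic_degree_identity[of "real \<delta>" r y] assms(3)
    unfolding w_def p_def c_def by simp
  have yw_ge: "(\<Sum>v\<in>?V. y v * w v) \<ge> 0" using y(1) w by (intro sum_nonneg) simp
  have p_ge: "(\<Sum>v\<in>?V. p v) \<ge> 0" using p by (intro sum_nonneg)
  have "c * (\<Sum>v\<in>?V. y v) \<ge> 0" using id yw_ge p_ge by linarith
  then have c0: "c = 0" using sum_y c(2) by (simp add: zero_le_mult_iff)
  then have "(\<Sum>v\<in>?V. y v * w v) = 0" "(\<Sum>v\<in>?V. p v) = 0" using id yw_ge p_ge by auto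
  then have yw0: "y v * w v = 0" and p0: "p v = 0" if "v \<in> ?V" for v
    using that y(1) w p pair_finite_verts by (simp_all add: sum_nonneg_eq_0_iff)
  \<comment> \<open>The first factor of \<open>p v\<close> is at least 1, so the second one is
    0.\<close>
  have eigen: "(\<Sum>u\<in>?N v. y u) = r * y v" if "v \<in> ?V" for v
    using p0[OF that] r(1) by (simp add: p_def)
  have "card (parcs G) = card ?F" using c(1) c0 cE by simp
  then have E: "parcs G = ?F" using card_subset_eq[OF finF EF] by simp
  have r_pos: "r > 0" using r(1) assms(6) by linarith

  \<comment> \<open>Since \<open>s\<close> is adjacent to all other vertices, the total weight is
    \<open>(1 + r) * y s\<close>, so \<open>y s > 0\<close>; the eigenvector equation passes
    positivity on to each neighbour of \<open>s\<close>.\<close>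
  have y_pos: "y v > 0" if v: "v \<in> ?V" for v
  proof -
    have sV: "s \<in> ?V" using s V by blast
    have Ns: "?N s = ?V - {s}" using s SAB sV unfolding E by auto
    have "y s > 0"
    proof -
      have "(\<Sum>v\<in>?V. y v) = y s + (\<Sum>u\<in>?N s. y u)"
        unfolding Ns using sV pair_finite_verts by (simp add: sum.remove)
      then have "(1 + r) * y s > 0" using sum_y eigen[OF sV] by (simp add: algebra_simps)
      then show ?thesis using r_pos by (simp add: zero_less_mult_iff)
    qed
    show ?thesis
    proof (cases "v = s")
      case False
      then have "s \<in> ?N v" using Ns v arcs_symmetric by blast
      then have "y s \<le> (\<Sum>u\<in>?N v. y u)" using y(1) by (intro member_le_sum) auto
      then have "r * y v > 0" using eigen[OF v] \<open>y s > 0\<close> by simp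
      then show ?thesis using r_pos by (simp add: zero_less_mult_iff)
    qed (use \<open>y s > 0\<close> in simp)
  qed
  \<comment> \<open>\<open>w v\<close> sums the excess degrees of the non-neighbours of
    \<open>v\<close>, and it vanishes because \<open>y v > 0\<close>.\<close>
  have nonadj: "card (?N u) = \<delta>" if "u \<in> ?V" "v \<in> ?V" "u \<noteq> v" "(v, u) \<notin> parcs G" for u v
  proof -
    have "w v = 0" using yw0[OF that(2)] y_pos[OF that(2)] by simp
    moreover have "real (card (?N u)) - real \<delta> \<le> w v"
      unfolding w_def using that pair_finite_verts min_degree_le assms(5)
      by (intro member_le_sum) auto
    ultimately show ?thesis using min_degree_le[OF that(1)] assms(5) by simp
  qed
  obtain x z where x: "x \<in> A" and z: "z \<in> B" using AB(1,2) by blast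
  then have xz: "x \<in> ?V" "z \<in> ?V" "x \<noteq> z" "(x, z) \<notin> parcs G" "(z, x) \<notin> parcs G"
    using V disj AB(3) BA by auto
  have "?N x = S \<union> (A - {x})" using x SAB disj unfolding E V by auto
  then have "card (?N x) = \<kappa> + (a - 1)"
    using x fin SAB S(2) by (simp add: card_Un_disjoint Int_Diff_disjoint a_def Diff_Int_distrib)
  then have a': "\<kappa> + a = \<delta> + 1" using nonadj[of x z] xz a \<kappa>_less by simp
  have "?N z = S \<union> (B - {z})" using z SAB disj unfolding E V by auto
  then have "card (?N z) = \<kappa> + (b - 1)"
    using z fin SAB S(2) by (simp add: card_Un_disjoint b_def Diff_Int_distrib)
  then have b': "\<kappa> + b = \<delta> + 1" using nonadj[of z x] xz b \<kappa>_less by simp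
  \<comment> \<open>Equality in the edge count gives this product. As both parts have size
    \<open>\<delta> + 1 - \<kappa>\<close>, also \<open>n - \<delta> - 1 = a\<close>, so the
    equation reads \<open>a * a = 2 * a\<close> with \<open>a > 0\<close>.\<close>
  have "real a * real b = 2 * (real n - real \<delta> - 1)"
    using c(3)[OF c0] cF by (simp add: q_def algebra_simps)
  moreover have "real b = real a" "real n - real \<delta> - 1 = real a" using a' b' n by auto
  ultimately have "real a = 2" using a \<kappa>_less by simp
  then have "a = 2" "b = 2" "\<kappa> = n - 4" using a' b' n by auto
  then have "card A = 2" "card B = 2" "card S = n - 4" using S(2) by (auto simp: a_def b_def)
  then show ?thesis
    using join_of_disjoint_union_iso[OF assms(1) V SAB disj E] by simp
qed simp

end
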